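(* Let $G$ be an acyclic directed mixed graph with finite vertex set $V$, and let $\tilde V\subseteq V$. Let $\sigma$ be a weight function on the edges of $G$ with associated matrices $\beta,\Lambda$ ($\Lambda$ positive semi-definite), such that the Gaussian linear system with parameters $(\beta,\Lambda)$ is principally stable, and let $\mathsf P$ be the distribution of $V$ in this system. Let $\tilde G$ be the marginal graph of $G$ on $\tilde V$. Then the marginal distribution of the sub-vector $\tilde V$ under $\mathsf P$ is the distribution of a principally non-singular Gaussian linear system with respect to $\tilde G$ whose weight function $\tilde\sigma$ is given by the parameters, for all $a,b\in\tilde V$, $$\tilde\beta_{ab}=\sigma\big(\{\text{right-directed walks from } a \text{ to } b \text{ in } G \text{ with no non-endpoint in } \tilde V\}\big),$$ $$\tilde\Lambda_{ab}=\sigma\big(\{\text{treks from } a \text{ to } b \text{ in } G \text{ with no non-endpoint in } \tilde V\}\big).$$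
   Context: A directed mixed graph $G=(V,\mathcal D,\mathcal B)$ consists of a finite vertex set $V=\{V_1,\dots,V_d\}$, a set $\mathcal D\subseteq V\times V$ of directed edges ($(a,b)\in\mathcal D$ is written $a\to b$) and a symmetric set $\mathcal B\subseteq V\times V$ of bidirected edges ($a\leftrightarrow b$); loops $a\to a$ and $a\leftrightarrow a$ are allowed in general. A walk from $a$ to $b$ is a sequence $a=v_0,e_1,v_1,\dots,e_n,v_n=b$, $n\ge 1$, where each $e_i$ is an edge $v_{i-1}\to v_i$, $v_{i-1}\leftarrow v_i$ (a directed edge $v_i\to v_{i-1}$ traversed backwards) or $v_{i-1}\leftrightarrow v_i$. Its non-endpoints are the entries at positions $v_1,\dots,v_{n-1}$ (so a vertex equal to $a$ or $b$ may also occur as a non-endpoint). A right-directed walk has all edges of the form $\to$. A trek is a walk consisting of a (possibly empty) sequence of edges $\leftarrow$, then exactly one bidirected edge $\leftrightarrow$, then a (possibly empty) sequence of edges $\to$. $G$ is acyclic if there is no right-directed walk from a vertex to itself. Marginal graph: for $\tilde V\subseteq V$, the marginal graph $\tilde G$ of $G$ has vertex set $\tilde V$; for $a,b\in\tilde V$, $a\to b$ in $\tilde G$ iff there is a right-directed walk from $a$ to $b$ in $G$ with no non-endpoint in $\tilde V$, and $a\leftrightarrow b$ in $\tilde G$ iff there is a trek from $a$ to $b$ in $G$ with no non-endpoint in $\tilde V$. Gaussian linear systems: vertices are identified with the components of a random vector $V=(V_1,\dots,V_d)$. A weight function $\sigma$ on a graph $G$ assigns a real number to each edge (with the same weight for $a\leftrightarrow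 b$ and $b\leftrightarrow a$; zero weights are permitted); it determines $d\times d$ matrices $\beta,\Lambda$ by $\beta_{ab}=\sigma(a\to b)$ if $a\to b$ in $G$ and $0$ otherwise, $\Lambda_{ab}=\sigma(a\leftrightarrow b)$ if $a\leftrightarrow b$ in $G$ and $0$ otherwise, and $\Lambda$ is required to be positive semi-definite. The weight of a walk is the product of the weights of its edges and the weight of a set of walks is the sum of the weights of its elements (the empty set has weight $0$). $V$ follows the Gaussian linear system with respect to $G$ with parameters $(\beta,\Lambda)$ if $V=\beta^TV+E$ with $E\sim \mathrm N(0,\Lambda)$. The system is principally non-singular if every principal sub-matrix of $\mathrm{Id}-\beta$ is invertible, and principally stable if every principal sub-matrix of $\beta$ has spectral radius less than $1$. *)

theory Defs
  imports
    "HOL-Probability.Probability"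
    "Jordan_Normal_Form.Spectral_Radius"
begin

record 'v mixed_graph =
  verts :: "'v set"
  directed :: "('v \<times> 'v) set"
  bidirected :: "('v \<times> 'v) set"

definition directed_mixed_graph :: "'v mixed_graph \<Rightarrow> bool" where
  "directed_mixed_graph G \<longleftrightarrow>
     finite (verts G) \<and> directed G \<subseteq> verts G \<times> verts G \<and>
     bidirected G \<subseteq> verts G \<times> verts G \<and> sym (bidirected G)"

(* The edges a -> b and a <-> b; DirE b a is the edge traversed by a backward step from a to b. *)
datatype 'v edge = DirE 'v 'v | BiE 'v 'v

datatype 'v step =
    Fwd (src: 'v) (tgt: 'v)
  | Bwd (src: 'v) (tgt: 'v)
  | Bid (src: 'v) (tgt: 'v)

fun step_edge :: "'v step \<Rightarrow> 'v edge" where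
  "step_edge (Fwd u v) = DirE u v"
| "step_edge (Bwd u v) = DirE v u"
| "step_edge (Bid u v) = BiE u v"

fun has_edge :: "'v mixed_graph \<Rightarrow> 'v edge \<Rightarrow> bool" where
  "has_edge G (DirE u v) \<longleftrightarrow> (u, v) \<in> directed G"
| "has_edge G (BiE u v) \<longleftrightarrow> (u, v) \<in> bidirected G"

definition walk :: "'v mixed_graph \<Rightarrow> 'v \<Rightarrow> 'v step list \<Rightarrow> 'v \<Rightarrow> bool" where
  "walk G a w b \<longleftrightarrow>
     w \<noteq> [] \<and> src (hd w) = a \<and> tgt (last w) = b \<and>
     (\<forall>s\<in>set w. has_edge G (step_edge s)) \<and>
     (\<forall>i. Suc i < length w \<longrightarrow> tgt (w ! i) = src (w ! Suc i))"

(* The entries at the positions v_1, ..., v_{n-1} of a walk v_0, ..., v_n. *)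
definition non_endpoints :: "'v step list \<Rightarrow> 'v set" where
  "non_endpoints w = src ` set (tl w)"

definition right_directed :: "'v step list \<Rightarrow> bool" where
  "right_directed w \<longleftrightarrow> (\<forall>s\<in>set w. is_Fwd s)"

definition trek_shape :: "'v step list \<Rightarrow> bool" where
  "trek_shape w \<longleftrightarrow>
     (\<exists>l m r. w = l @ [m] @ r \<and> (\<forall>s\<in>set l. is_Bwd s) \<and> is_Bid m \<and> (\<forall>s\<in>set r. is_Fwd s))"

definition acyclic_graph :: "'v mixed_graph \<Rightarrow> bool" where
  "acyclic_graph G \<longleftrightarrow> (\<forall>a\<in>verts G. \<not> (\<exists>w. walk G a w a \<and> right_directed w))"

definition directed_walks_avoiding ::
    "'v mixed_graph \<Rightarrow> 'v set \<Rightarrow> 'v \<Rightarrow> 'v \<Rightarrow> 'v step list set" where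
  "directed_walks_avoiding G U a b =
     {w. walk G a w b \<and> right_directed w \<and> non_endpoints w \<inter> U = {}}"

definition treks_avoiding ::
    "'v mixed_graph \<Rightarrow> 'v set \<Rightarrow> 'v \<Rightarrow> 'v \<Rightarrow> 'v step list set" where
  "treks_avoiding G U a b =
     {w. walk G a w b \<and> trek_shape w \<and> non_endpoints w \<inter> U = {}}"

definition marginal_graph :: "'v mixed_graph \<Rightarrow> 'v set \<Rightarrow> 'v mixed_graph" where
  "marginal_graph G U =
     \<lparr> verts = U,
       directed = {(a, b). a \<in> U \<and> b \<in> U \<and> directed_walks_avoiding G U a b \<noteq> {}},
       bidirected = {(a, b). a \<in> U \<and> b \<in> U \<and> treks_avoiding G U a b \<noteq> {}} \<rparr>"

(* A weight function is total on the type of edges; its values off the edges of G are never used. *)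
type_synonym 'v weights = "'v edge \<Rightarrow> real"

definition beta :: "'v mixed_graph \<Rightarrow> 'v weights \<Rightarrow> 'v \<Rightarrow> 'v \<Rightarrow> real" where
  "beta G \<sigma> a b = (if (a, b) \<in> directed G then \<sigma> (DirE a b) else 0)"

definition Lambda :: "'v mixed_graph \<Rightarrow> 'v weights \<Rightarrow> 'v \<Rightarrow> 'v \<Rightarrow> real" where
  "Lambda G \<sigma> a b = (if (a, b) \<in> bidirected G then \<sigma> (BiE a b) else 0)"

definition positive_semidefinite :: "'v set \<Rightarrow> ('v \<Rightarrow> 'v \<Rightarrow> real) \<Rightarrow> bool" where
  "positive_semidefinite V A \<longleftrightarrow>
     (\<forall>a\<in>V. \<forall>b\<in>V. A a b = A b a) \<and>
     (\<forall>x. 0 \<le> (\<Sum>a\<in>V. \<Sum>b\<in>V. x a * A a b * x b))"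

definition weight_function :: "'v mixed_graph \<Rightarrow> 'v weights \<Rightarrow> bool" where
  "weight_function G \<sigma> \<longleftrightarrow>
     (\<forall>(a, b)\<in>bidirected G. \<sigma> (BiE a b) = \<sigma> (BiE b a)) \<and>
     positive_semidefinite (verts G) (Lambda G \<sigma>)"

definition walk_weight :: "'v weights \<Rightarrow> 'v step list \<Rightarrow> real" where
  "walk_weight \<sigma> w = prod_list (map (\<lambda>s. \<sigma> (step_edge s)) w)"

definition walks_weight :: "'v weights \<Rightarrow> 'v step list set \<Rightarrow> real" where
  "walks_weight \<sigma> W = (\<Sum>\<^sub>\<infinity>w\<in>W. walk_weight \<sigma> w)"

(* Matrices are indexed by vertices. A principal sub-matrix is turned into a library matrix by
   listing its index set; the predicates below range over all listings of all nonempty index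
   sets. Different listings of one set give matrices that are similar by a permutation. *)
definition principal_submatrix :: "('v \<Rightarrow> 'v \<Rightarrow> 'a) \<Rightarrow> 'v list \<Rightarrow> 'a mat" where
  "principal_submatrix A vs = mat (length vs) (length vs) (\<lambda>(i, j). A (vs ! i) (vs ! j))"

definition principally_nonsingular :: "'v set \<Rightarrow> ('v \<Rightarrow> 'v \<Rightarrow> real) \<Rightarrow> bool" where
  "principally_nonsingular V B \<longleftrightarrow>
     (\<forall>vs. vs \<noteq> [] \<and> distinct vs \<and> set vs \<subseteq> V \<longrightarrow>
        invertible_mat (principal_submatrix (\<lambda>a b. (if a = b then 1 else 0) - B a b) vs))"

definition principally_stable :: "'v set \<Rightarrow> ('v \<Rightarrow> 'v \<Rightarrow> real) \<Rightarrow> bool" where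
  "principally_stable V B \<longleftrightarrow>
     (\<forall>vs. vs \<noteq> [] \<and> distinct vs \<and> set vs \<subseteq> V \<longrightarrow>
        spectral_radius (principal_submatrix (\<lambda>a b. complex_of_real (B a b)) vs) < 1)"

(* N(0, v), where N(0, 0) is the point mass at 0. *)
definition centered_normal :: "'w measure \<Rightarrow> ('w \<Rightarrow> real) \<Rightarrow> real \<Rightarrow> bool" where
  "centered_normal M Y v \<longleftrightarrow>
     Y \<in> borel_measurable M \<and>
     (if v = 0 then AE \<omega> in M. Y \<omega> = 0
      else 0 < v \<and> distributed M lborel Y (\<lambda>x. ennreal (normal_density 0 (sqrt v) x)))"

abbreviation vector_space_on :: "'v set \<Rightarrow> ('v \<Rightarrow> real) measure" where
  "vector_space_on V \<equiv> PiM V (\<lambda>_. borel)"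

(* The possibly degenerate multivariate normal distribution N(0, C): every linear combination
   t^T E is univariate normal with mean 0 and variance t^T C t. *)
definition centered_gaussian ::
    "'w measure \<Rightarrow> 'v set \<Rightarrow> ('w \<Rightarrow> 'v \<Rightarrow> real) \<Rightarrow> ('v \<Rightarrow> 'v \<Rightarrow> real) \<Rightarrow> bool" where
  "centered_gaussian M V E C \<longleftrightarrow>
     E \<in> M \<rightarrow>\<^sub>M vector_space_on V \<and>
     (\<forall>t. centered_normal M (\<lambda>\<omega>. \<Sum>a\<in>V. t a * E \<omega> a) (\<Sum>a\<in>V. \<Sum>b\<in>V. t a * C a b * t b))"

definition gaussian_linear_system ::
    "'v mixed_graph \<Rightarrow> 'v weights \<Rightarrow> 'w measure \<Rightarrow> ('w \<Rightarrow> 'v \<Rightarrow> real) \<Rightarrow> bool" where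
  "gaussian_linear_system G \<sigma> M X \<longleftrightarrow>
     X \<in> M \<rightarrow>\<^sub>M vector_space_on (verts G) \<and>
     (\<exists>E. centered_gaussian M (verts G) E (Lambda G \<sigma>) \<and>
        (AE \<omega> in M. \<forall>b\<in>verts G. X \<omega> b = (\<Sum>a\<in>verts G. beta G \<sigma> a b * X \<omega> a) + E \<omega> b))"

(* The law Q of a random vector following the system. The probability space is taken on the
   type of vectors; this is no restriction, since E is determined by X almost surely, so Q
   itself with the identity as random vector always serves. *)
definition gls_distribution ::
    "'v mixed_graph \<Rightarrow> 'v weights \<Rightarrow> ('v \<Rightarrow> real) measure \<Rightarrow> bool" where
  "gls_distribution G \<sigma> Q \<longleftrightarrow>
     (\<exists>(M :: ('v \<Rightarrow> real) measure) X.
        prob_space M \<and> gaussian_linear_system G \<sigma> M X \<and>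
        Q = distr M (vector_space_on (verts G)) X)"

definition marginal_distribution ::
    "('v \<Rightarrow> real) measure \<Rightarrow> 'v set \<Rightarrow> ('v \<Rightarrow> real) measure" where
  "marginal_distribution P U = distr P (vector_space_on U) (\<lambda>x. restrict x U)"

end

theory Submission
  imports Defs
begin

text \<open>
  Let \<open>K c b\<close> be the total weight of the possibly empty right-directed walks from \<open>c\<close> to \<open>b\<close>, all
  of whose positions but the last lie outside \<open>U\<close>. Splitting off the first edge of a
  directed walk and the bidirected edge of a trek gives \<open>\<beta>' = \<beta> K\<close>, \<open>\<Lambda>' = K\<^sup>T \<Lambda> K\<close> and
  \<open>K c b = [c = b] + [c \<notin> U] \<beta>' c b\<close>, all sums being finite by acyclicity. Multiplying
  \<open>X = \<beta>\<^sup>T X + E\<close> by \<open>K\<^sup>T\<close>, the terms \<open>\<beta>' c b * X c\<close> with \<open>c \<notin> U\<close> cancel, leaving a system on \<open>U\<close>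
  with error \<open>K\<^sup>T E\<close>.
\<close>

section \<open>Walks\<close>

text \<open>Recursive form of \<open>walk\<close> that also admits the empty walk, needed for tails
  of directed walks and for arms of treks.\<close>

fun steps :: "'v mixed_graph \<Rightarrow> 'v \<Rightarrow> 'v step list \<Rightarrow> 'v \<Rightarrow> bool" where
  "steps G a [] b \<longleftrightarrow> a = b"
| "steps G a (s # w) b \<longleftrightarrow> src s = a \<and> has_edge G (step_edge s) \<and> steps G (tgt s) w b"

lemma walk_Cons:
  "walk G a (s # w) b \<longleftrightarrow> src s = a \<and> has_edge G (step_edge s) \<and>
     (if w = [] then tgt s = b else walk G (tgt s) w b)"
proof (cases w)
  case (Cons s' w')
  have "(\<forall>i. Suc i < length (s # w) \<longrightarrow> tgt ((s # w) ! i) = src ((s # w) ! Suc i)) \<longleftrightarrow>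
    tgt s = src (hd w) \<and> (\<forall>i. Suc i < length w \<longrightarrow> tgt (w ! i) = src (w ! Suc i))"
    (is "?l \<longleftrightarrow> ?r")
  proof
    assume l: ?l
    have "tgt (w ! i) = src (w ! Suc i)" if "Suc i < length w" for i
      using l[rule_format, of "Suc i"] that by simp
    then show ?r using l[rule_format, of 0] Cons by simp
  next
    assume ?r
    then show ?l using Cons by (auto simp: nth_Cons split: nat.split)
  qed
  then show ?thesis using Cons unfolding walk_def by auto
qed (auto simp: walk_def)

lemma walk_iff_steps: "walk G a w b \<longleftrightarrow> w \<noteq> [] \<and> steps G a w b"
proof (induction w arbitrary: a)
  case Nil
  then show ?case by (simp add: walk_def)
next
  case (Cons s w)
  then show ?case by (cases w) (simp_all add: walk_Cons)
qed

lemma steps_append: "steps G a (u @ w) b \<longleftrightarrow> (\<exists>c. steps G a u c \<and> steps G c w b)"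
  by (induction u arbitrary: a) auto

section \<open>Reversal of steps and of directed walks\<close>

fun flip :: "'v step \<Rightarrow> 'v step" where
  "flip (Fwd a b) = Bwd b a"
| "flip (Bwd a b) = Fwd b a"
| "flip (Bid a b) = Bid b a"

lemma flip_flip [simp]: "flip (flip s) = s"
  by (cases s) auto

lemma src_flip [simp]: "src (flip s) = tgt s" and tgt_flip [simp]: "tgt (flip s) = src s"
  by (cases s; simp)+

lemma is_flip [simp]: "is_Fwd (flip s) \<longleftrightarrow> is_Bwd s" "is_Bwd (flip s) \<longleftrightarrow> is_Fwd s"
  by (cases s; simp)+

lemma step_edge_flip: "is_Fwd s \<Longrightarrow> step_edge (flip s) = step_edge s"
  by (cases s) auto

text \<open>Flipping keeps the edge of a directed step, whereas a bidirected step would turn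
  \<open>BiE c d\<close> into \<open>BiE d c\<close>; hence the restriction to forward
  steps.\<close>

lemma steps_rev_flip:
  assumes "\<forall>s\<in>set w. is_Fwd s"
  shows "steps G a (rev (map flip w)) c \<longleftrightarrow> steps G c w a"
  using assms by (induction w arbitrary: c) (auto simp: steps_append step_edge_flip)

text \<open>Prepares the non-endpoints of a trek: with the bidirected edge appended, the reversed
  left arm starts at the endpoint \<open>a\<close>, and dropping this entry leaves exactly the
  sources of the unreversed arm.\<close>

lemma map_src_rev_flip:
  assumes "steps G c w a"
  shows "map src (rev (map flip w) @ [Bid c d]) = a # rev (map src w)"
  using assms
proof (induction w arbitrary: c d)
  case (Cons s w)
  then have "map src (rev (map flip w) @ [Bid (tgt s) d]) = a # rev (map src w)"
    by auto
  with Cons.prems show ?case by simp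
qed simp

lemma walk_weight_simps [simp]:
  "walk_weight \<sigma> [] = 1"
  "walk_weight \<sigma> (s # w) = \<sigma> (step_edge s) * walk_weight \<sigma> w"
  "walk_weight \<sigma> (u @ w) = walk_weight \<sigma> u * walk_weight \<sigma> w"
  by (simp_all add: walk_weight_def)

lemma walk_weight_rev_flip:
  assumes "\<forall>s\<in>set w. is_Fwd s"
  shows "walk_weight \<sigma> (rev (map flip w)) = walk_weight \<sigma> w"
  using assms by (induction w) (auto simp: step_edge_flip)

text \<open>A pair in the transitive closure is realised by a right-directed walk built edge by
  edge, so a cycle of the relation would be a forbidden closed walk.\<close>

lemma acyclic_directed:
  assumes "directed_mixed_graph G" "acyclic_graph G"
  shows "acyclic (directed G)"
proof -
  have walk: "\<exists>w. walk G a w b \<and> right_directed w" if "(a, b) \<in> (directed G)\<^sup>+" for a b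
    using that
  proof (induction rule: trancl_induct)
    case (base b)
    then have "walk G a [Fwd a b] b \<and> right_directed [Fwd a b]"
      by (simp add: walk_iff_steps right_directed_def)
    then show ?case by blast
  next
    case (step b c)
    then obtain w where "walk G a w b" "right_directed w" by blast
    with step.hyps have "walk G a (w @ [Fwd b c]) c \<and> right_directed (w @ [Fwd b c])"
      by (auto simp: walk_iff_steps steps_append right_directed_def)
    then show ?case by blast
  qed
  \<comment> \<open>\<open>acyclic_graph\<close> speaks about vertices of \<open>G\<close> only, so
    a cycle must first be located there.\<close>
  have "a \<in> verts G" if "(a, a) \<in> (directed G)\<^sup>+" for a
    using that assms(1) unfolding directed_mixed_graph_def
    by (meson SigmaD1 subsetD tranclD)
  with walk assms(2) show ?thesis
    unfolding acyclic_def acyclic_graph_def by blast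
qed

lemma finite_directed: "directed_mixed_graph G \<Longrightarrow> finite (directed G)"
  unfolding directed_mixed_graph_def by (meson finite_SigmaI finite_subset)

text \<open>The converse makes successors smaller: induction over it proves a claim for
  \<open>a\<close> from all \<open>c\<close> with \<open>(a, c) \<in> directed G\<close>.\<close>

lemma wf_converse_directed:
  assumes "directed_mixed_graph G" "acyclic_graph G"
  shows "wf ((directed G)\<inverse>)"
  using assms by (intro finite_acyclic_wf_converse acyclic_directed finite_directed)

section \<open>Weights of directed walks and of treks\<close>

text \<open>The walks whose total weight is \<open>K a b\<close>. The start must avoid
  \<open>U\<close> too, so from a vertex of \<open>U\<close> only the empty walk remains.\<close>

definition exits :: "'v mixed_graph \<Rightarrow> 'v set \<Rightarrow> 'v \<Rightarrow> 'v \<Rightarrow> 'v step list set" where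
  "exits G U a b = {w. steps G a w b \<and> right_directed w \<and> src ` set w \<inter> U = {}}"

text \<open>The sources in the tail after the first edge are exactly the non-endpoints of the whole
  walk; the start \<open>a\<close> stays unconstrained.\<close>

lemma directed_walks_avoiding_eq:
  "directed_walks_avoiding G U a b =
     (\<lambda>(c, w). Fwd a c # w) ` (SIGMA c:directed G `` {a}. exits G U c b)" (is "?l = ?r")
proof (rule Set.set_eqI)
  fix w
  show "w \<in> ?l \<longleftrightarrow> w \<in> ?r"
  proof (cases w)
    case Nil
    then show ?thesis by (auto simp: directed_walks_avoiding_def walk_iff_steps)
  next
    case (Cons s w')
    then show ?thesis
      by (cases s) (auto simp: directed_walks_avoiding_def walk_iff_steps exits_def
        right_directed_def non_endpoints_def image_iff)
  qed
qed

text \<open>The sources of a nonempty walk are its start and its non-endpoints. This closes the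
  recursion between the two kinds of walk sets.\<close>

lemma exits_eq:
  "exits G U c b =
     (if c = b then {[]} else {}) \<union> (if c \<in> U then {} else directed_walks_avoiding G U c b)"
    (is "?l = ?r")
proof (rule Set.set_eqI)
  fix w
  show "w \<in> ?l \<longleftrightarrow> w \<in> ?r"
    by (cases w) (auto simp: exits_def directed_walks_avoiding_def walk_iff_steps
        right_directed_def non_endpoints_def)
qed

text \<open>The bidirected step is the first one that is not backward, which fixes its
  position.\<close>

lemma trek_decomposition_unique:
  assumes "l @ m # r = l' @ m' # r'"
    and "\<forall>s\<in>set l. is_Bwd s" "is_Bid m" "\<forall>s\<in>set l'. is_Bwd s" "is_Bid m'"
  shows "l = l' \<and> m = m' \<and> r = r'"
  using assms
proof (induction l arbitrary: l')
  case Nil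
  then show ?case by (cases l') auto
next
  case (Cons s l)
  then show ?case by (cases l') auto
qed

text \<open>Both arms are given as directed walks read outwards from the bidirected edge; the left
  one is reversed on assembly.\<close>

definition trek_of :: "('v \<times> 'v) \<times> 'v step list \<times> 'v step list \<Rightarrow> 'v step list" where
  "trek_of = (\<lambda>((c, d), l, r). rev (map flip l) @ [Bid c d] @ r)"

text \<open>Seen outwards from the bidirected edge, the non-endpoints of a trek are the sources of
  the steps in its arms, so avoiding \<open>U\<close> splits into one condition per arm.\<close>

lemma treks_avoiding_eq:
  "treks_avoiding G U a b =
     trek_of ` (SIGMA (c, d):bidirected G. exits G U c a \<times> exits G U d b)" (is "?l = ?r")
proof (rule Set.set_eqI)
  fix w
  \<comment> \<open>As an equivalence for arbitrary directed arms, this serves both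
    inclusions.\<close>
  have split: "(trek_of ((c, d), l, r) \<in> treks_avoiding G U a b) \<longleftrightarrow>
      (c, d) \<in> bidirected G \<and> l \<in> exits G U c a \<and> r \<in> exits G U d b"
    if "right_directed l" "right_directed r" for c d l r
  proof -
    have shape: "trek_shape (trek_of ((c, d), l, r))"
      unfolding trek_shape_def
      by (intro exI[of _ "rev (map flip l)"] exI[of _ "Bid c d"] exI[of _ r])
        (use that in \<open>auto simp: trek_of_def right_directed_def\<close>)
    have walk: "walk G a (trek_of ((c, d), l, r)) b \<longleftrightarrow>
        (c, d) \<in> bidirected G \<and> steps G c l a \<and> steps G d r b"
      using that steps_rev_flip[of l G a]
      by (auto simp: walk_iff_steps trek_of_def steps_append right_directed_def)
    have ends: "non_endpoints (trek_of ((c, d), l, r)) = src ` set l \<union> src ` set r"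
      if "steps G c l a"
    proof -
      let ?m = "map src (rev (map flip l) @ [Bid c d])"
      have "src ` set (tl (trek_of ((c, d), l, r))) = set (tl (map src (trek_of ((c, d), l, r))))"
        by (metis list.set_map map_tl)
      also have "map src (trek_of ((c, d), l, r)) = ?m @ map src r"
        by (simp add: trek_of_def)
      finally show ?thesis
        unfolding non_endpoints_def map_src_rev_flip[OF that] by auto
    qed
    show ?thesis
    proof (cases "steps G c l a")
      case True
      then show ?thesis
        using that shape walk by (auto simp: treks_avoiding_def exits_def ends Int_Un_distrib2)
    qed (simp add: treks_avoiding_def exits_def walk)
  qed
  show "w \<in> ?l \<longleftrightarrow> w \<in> ?r"
  proof
    assume w: "w \<in> ?l"
    then obtain l m r where lmr: "w = l @ [m] @ r" "\<forall>s\<in>set l. is_Bwd s" "is_Bid m"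
        "right_directed r"
      unfolding treks_avoiding_def trek_shape_def right_directed_def by blast
    then obtain c d where m: "m = Bid c d" by (cases m) auto
    \<comment> \<open>Reversing and flipping is an involution, so it recovers the outward left
      arm.\<close>
    have l: "right_directed (rev (map flip l))"
      using lmr(2) by (auto simp: right_directed_def)
    have w_eq: "w = trek_of ((c, d), rev (map flip l), r)"
      using lmr m by (simp add: trek_of_def rev_map o_def)
    then show "w \<in> ?r"
      using split[OF l lmr(4), of c d] w by auto
  next
    assume "w \<in> ?r"
    then show "w \<in> ?l"
      using split by (auto simp: exits_def)
  qed
qed

lemma inj_on_trek_of:
  "inj_on trek_of (SIGMA (c, d):B. exits G U c a \<times> exits G U d b)"
proof (rule inj_onI)
  fix x y
  assume x: "x \<in> (SIGMA (c, d):B. exits G U c a \<times> exits G U d b)"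
    and y: "y \<in> (SIGMA (c, d):B. exits G U c a \<times> exits G U d b)"
    and eq: "trek_of x = trek_of y"
  obtain c d l r where x_eq: "x = ((c, d), l, r)" by (metis prod.collapse)
  obtain c' d' l' r' where y_eq: "y = ((c', d'), l', r')" by (metis prod.collapse)
  have "right_directed l" "right_directed l'"
    using x y x_eq y_eq by (auto simp: exits_def)
  then have "rev (map flip l) = rev (map flip l') \<and> Bid c d = Bid c' d' \<and> r = r'"
    using eq unfolding x_eq y_eq trek_of_def right_directed_def
    by (intro trek_decomposition_unique) auto
  moreover have "inj (map flip)" by (intro inj_mapI injI) (metis flip_flip)
  then have "l = l'" if "map flip l = map flip l'"
    using that by (rule injD)
  ultimately show "x = y"
    by (simp add: x_eq y_eq)
qed

text \<open>Well-founded induction from a vertex to its successors: there are finitely many first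
  edges, and each tail is empty or covered by the induction hypothesis.\<close>

lemma finite_walks_avoiding:
  assumes "directed_mixed_graph G" "acyclic_graph G"
  shows "finite (directed_walks_avoiding G U a b)"
  using wf_converse_directed[OF assms]
proof (induction a rule: wf_induct_rule)
  case (less a)
  have "finite (directed G `` {a})"
    using finite_directed[OF assms(1)] by simp
  moreover have "finite (exits G U c b)" if "(a, c) \<in> directed G" for c
    using less.IH[of c] that by (auto simp: exits_eq)
  ultimately show ?case
    by (auto simp: directed_walks_avoiding_eq)
qed

lemma finite_exits:
  assumes "directed_mixed_graph G" "acyclic_graph G"
  shows "finite (exits G U a b)"
  using finite_walks_avoiding[OF assms] by (auto simp: exits_eq)

text \<open>The identity \<open>\<beta>' = \<beta> K\<close>, obtained by sorting walks by their
  first edge.\<close>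

lemma directed_weight_eq:
  assumes G: "directed_mixed_graph G" "acyclic_graph G"
  shows "walks_weight \<sigma> (directed_walks_avoiding G U a b) =
    (\<Sum>c\<in>verts G. beta G \<sigma> a c * walks_weight \<sigma> (exits G U c b))"
proof -
  have fin: "finite (directed G `` {a})"
    using finite_directed[OF G(1)] by simp
  have inj: "inj_on (\<lambda>(c, w). Fwd a c # w) S" for S
    by (auto intro!: inj_onI)
  have "walks_weight \<sigma> (directed_walks_avoiding G U a b) =
      (\<Sum>w\<in>directed_walks_avoiding G U a b. walk_weight \<sigma> w)"
    by (simp add: walks_weight_def finite_walks_avoiding[OF G])
  also have "\<dots> = (\<Sum>(c, w)\<in>(SIGMA c:directed G `` {a}. exits G U c b).
      \<sigma> (DirE a c) * walk_weight \<sigma> w)"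
    unfolding directed_walks_avoiding_eq
    by (subst sum.reindex[OF inj]) (simp add: o_def case_prod_unfold)
  also have "\<dots> = (\<Sum>c\<in>directed G `` {a}. \<Sum>w\<in>exits G U c b. \<sigma> (DirE a c) * walk_weight \<sigma> w)"
    by (subst sum.Sigma) (auto simp: fin finite_exits[OF G])
  also have "\<dots> = (\<Sum>c\<in>directed G `` {a}. beta G \<sigma> a c * walks_weight \<sigma> (exits G U c b))"
    by (simp add: beta_def walks_weight_def finite_exits[OF G] sum_distrib_left)
  \<comment> \<open>\<open>beta\<close> vanishes off the edges, so the additional vertices
    contribute zero.\<close>
  also have "\<dots> = (\<Sum>c\<in>verts G. beta G \<sigma> a c * walks_weight \<sigma> (exits G U c b))"
    using G(1) by (intro sum.mono_neutral_left) (auto simp: directed_mixed_graph_def beta_def)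
  finally show ?thesis .
qed

lemma exits_weight_eq:
  assumes G: "directed_mixed_graph G" "acyclic_graph G"
  shows "walks_weight \<sigma> (exits G U c b) =
    (if c = b then 1 else 0) +
    (if c \<in> U then 0 else walks_weight \<sigma> (directed_walks_avoiding G U c b))"
proof -
  \<comment> \<open>This makes the union in \<open>exits_eq\<close> disjoint; the empty walk
    contributes the empty product 1.\<close>
  have "[] \<notin> directed_walks_avoiding G U a b" for a
    by (simp add: directed_walks_avoiding_def walk_def)
  then show ?thesis
    by (simp add: exits_eq walks_weight_def finite_walks_avoiding[OF G])
qed

text \<open>The identity \<open>\<Lambda>' = K\<^sup>T \<Lambda> K\<close>: reversal preserves the
  weight of the left arm, and for a fixed bidirected edge the two arms vary independently, so the
  sum factors.\<close>

lemma trek_weight_eq: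
  assumes G: "directed_mixed_graph G" "acyclic_graph G"
  shows "walks_weight \<sigma> (treks_avoiding G U a b) =
    (\<Sum>c\<in>verts G. \<Sum>d\<in>verts G.
       walks_weight \<sigma> (exits G U c a) * Lambda G \<sigma> c d * walks_weight \<sigma> (exits G U d b))"
proof -
  let ?K = "\<lambda>c b. walks_weight \<sigma> (exits G U c b)"
  let ?S = "SIGMA (c, d):bidirected G. exits G U c a \<times> exits G U d b"
  have V: "finite (verts G)" and sub: "bidirected G \<subseteq> verts G \<times> verts G"
    using G(1) by (auto simp: directed_mixed_graph_def)
  have fin: "finite (bidirected G)"
    using V sub by (meson finite_SigmaI finite_subset)
  have fin_S: "finite ?S"
    using fin finite_exits[OF G] by auto
  have "walks_weight \<sigma> (treks_avoiding G U a b) = (\<Sum>x\<in>?S. walk_weight \<sigma> (trek_of x))"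
    using fin_S unfolding treks_avoiding_eq walks_weight_def
    by (simp add: sum.reindex[OF inj_on_trek_of])
  also have "\<dots> = (\<Sum>((c, d), l, r)\<in>?S. walk_weight \<sigma> l * \<sigma> (BiE c d) * walk_weight \<sigma> r)"
    by (intro sum.cong)
      (auto simp: trek_of_def exits_def right_directed_def walk_weight_rev_flip)
  also have "\<dots> = (\<Sum>(c, d)\<in>bidirected G. \<Sum>(l, r)\<in>exits G U c a \<times> exits G U d b.
      walk_weight \<sigma> l * \<sigma> (BiE c d) * walk_weight \<sigma> r)"
    using fin finite_exits[OF G] by (subst sum.Sigma[symmetric]) (auto simp: case_prod_unfold)
  also have "\<dots> = (\<Sum>(c, d)\<in>bidirected G. ?K c a * Lambda G \<sigma> c d * ?K d b)"
    by (intro sum.cong)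
      (auto simp: walks_weight_def finite_exits[OF G] Lambda_def
        simp flip: sum.cartesian_product sum_distrib_left sum_distrib_right)
  also have "\<dots> = (\<Sum>(c, d)\<in>verts G \<times> verts G. ?K c a * Lambda G \<sigma> c d * ?K d b)"
    using V sub by (intro sum.mono_neutral_left) (auto simp: Lambda_def)
  also have "\<dots> = (\<Sum>c\<in>verts G. \<Sum>d\<in>verts G. ?K c a * Lambda G \<sigma> c d * ?K d b)"
    by (simp add: sum.cartesian_product)
  finally show ?thesis .
qed

section \<open>Principal non-singularity\<close>

text \<open>A kernel vector of \<open>Id - B\<close> satisfies \<open>v = B v\<close>. Each entry is
  then a combination of entries at \<open>r\<close>-smaller vertices, and well-founded induction
  makes all of them zero.\<close>

lemma principally_nonsingular_if_wf:
  assumes wf: "wf r" and supp: "\<And>a b. B a b \<noteq> 0 \<Longrightarrow> (b, a) \<in> r"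
  shows "principally_nonsingular V B"
  unfolding principally_nonsingular_def
proof (intro allI impI)
  fix vs
  assume "vs \<noteq> [] \<and> distinct vs \<and> set vs \<subseteq> V"
  then have dist: "distinct vs" by simp
  define n where "n = length vs"
  define A where "A = principal_submatrix (\<lambda>a b. (if a = b then 1 else 0) - B a b) vs"
  have A: "A \<in> carrier_mat n n"
    by (simp add: A_def principal_submatrix_def n_def)
  have "v = 0\<^sub>v n" if v: "v \<in> carrier_vec n" and ker: "A *\<^sub>v v = 0\<^sub>v n" for v
  proof -
    have fix_pt: "vec_index v i = (\<Sum>j<n. B (vs ! i) (vs ! j) * vec_index v j)" if "i < n" for i
    proof -
      have "0 = vec_index (A *\<^sub>v v) i" using ker that by simp
      also have "\<dots> = (\<Sum>j<n. ((if vs ! i = vs ! j then 1 else 0) - B (vs ! i) (vs ! j)) *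
          vec_index v j)"
        using that v by (auto simp: A_def principal_submatrix_def n_def scalar_prod_def
          atLeast0LessThan intro!: sum.cong)
      \<comment> \<open>Distinctness of \<open>vs\<close> turns equal vertices into equal indices
        and isolates the diagonal term.\<close>
      also have "\<dots> = (\<Sum>j<n. (if i = j then vec_index v j else 0) -
          B (vs ! i) (vs ! j) * vec_index v j)"
        using that dist by (intro sum.cong) (auto simp: n_def nth_eq_iff_index_eq left_diff_distrib)
      also have "\<dots> = vec_index v i - (\<Sum>j<n. B (vs ! i) (vs ! j) * vec_index v j)"
        using that by (simp add: sum_subtractf)
      finally show ?thesis by simp
    qed
    have "vec_index v i = 0" if "i < n" for i
      using wf that
    proof (induction "vs ! i" arbitrary: i rule: wf_induct_rule)
      case less
      \<comment> \<open>Either the coefficient is zero or \<open>vs ! j\<close> lies below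
        \<open>vs ! i\<close>.\<close>
      have "B (vs ! i) (vs ! j) * vec_index v j = 0" if "j < n" for j
        using less.hyps[OF supp that] by fastforce
      then have "(\<Sum>j<n. B (vs ! i) (vs ! j) * vec_index v j) = 0"
        by (intro sum.neutral) simp
      then show ?case by (rule trans[OF fix_pt[OF less.prems]])
    qed
    then show ?thesis using v by (intro eq_vecI) auto
  qed
  then have "det A \<noteq> 0"
    using det_0_iff_vec_prod_zero[OF A] by blast
  then have "A \<in> Units (ring_mat TYPE(real) n ())"
    by (rule det_non_zero_imp_unit[OF A])
  then have "invertible_mat A"
    using A by (auto simp: Units_def ring_mat_def invertible_mat_def inverts_mat_def)
  then show "invertible_mat (principal_submatrix (\<lambda>a b. (if a = b then 1 else 0) - B a b) vs)"
    by (simp add: A_def)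
qed

section \<open>Gaussian vectors\<close>

text \<open>The form of \<open>K\<^sup>T C K\<close> at \<open>t\<close> is the form of
  \<open>C\<close> at \<open>K t\<close>. It yields both positive semi-definiteness and the
  variances of a linear image.\<close>

lemma quadratic_form_transform:
  fixes C :: "'v \<Rightarrow> 'v \<Rightarrow> real"
  shows "(\<Sum>a\<in>U. \<Sum>b\<in>U. t a * (\<Sum>c\<in>V. \<Sum>d\<in>V. K c a * C c d * K d b) * t b) =
    (\<Sum>c\<in>V. \<Sum>d\<in>V. (\<Sum>a\<in>U. t a * K c a) * C c d * (\<Sum>b\<in>U. t b * K d b))"
proof -
  have "(\<Sum>a\<in>U. \<Sum>b\<in>U. t a * (\<Sum>c\<in>V. \<Sum>d\<in>V. K c a * C c d * K d b) * t b) =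
     (\<Sum>a\<in>U. \<Sum>b\<in>U. \<Sum>c\<in>V. \<Sum>d\<in>V. t a * K c a * C c d * (t b * K d b))"
    by (simp add: sum_distrib_left sum_distrib_right mult_ac)
  also have "\<dots> = (\<Sum>a\<in>U. \<Sum>c\<in>V. \<Sum>d\<in>V. \<Sum>b\<in>U. t a * K c a * C c d * (t b * K d b))"
    by (intro sum.cong[OF refl], subst sum.swap, intro sum.cong[OF refl], subst sum.swap) simp
  also have "\<dots> = (\<Sum>c\<in>V. \<Sum>d\<in>V. \<Sum>a\<in>U. \<Sum>b\<in>U. t a * K c a * C c d * (t b * K d b))"
    by (subst sum.swap, intro sum.cong[OF refl], subst sum.swap) simp
  also have "\<dots> = (\<Sum>c\<in>V. \<Sum>d\<in>V. (\<Sum>a\<in>U. t a * K c a) * C c d * (\<Sum>b\<in>U. t b * K d b))"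
    by (simp flip: sum_distrib_left sum_distrib_right)
  finally show ?thesis .
qed

lemma positive_semidefinite_transform:
  assumes "positive_semidefinite V C"
  shows "positive_semidefinite U (\<lambda>a b. \<Sum>c\<in>V. \<Sum>d\<in>V. K c a * C c d * K d b)"
  unfolding positive_semidefinite_def
proof (intro conjI ballI allI)
  fix a b
  have "(\<Sum>c\<in>V. \<Sum>d\<in>V. K c a * C c d * K d b) = (\<Sum>c\<in>V. \<Sum>d\<in>V. K d b * C d c * K c a)"
    using assms by (intro sum.cong) (auto simp: positive_semidefinite_def)
  also have "\<dots> = (\<Sum>c\<in>V. \<Sum>d\<in>V. K c b * C c d * K d a)"
    by (rule sum.swap)
  finally show "(\<Sum>c\<in>V. \<Sum>d\<in>V. K c a * C c d * K d b) =
      (\<Sum>c\<in>V. \<Sum>d\<in>V. K c b * C c d * K d a)" .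
next
  fix x
  have nonneg: "0 \<le> (\<Sum>c\<in>V. \<Sum>d\<in>V. y c * C c d * y d)" for y
    using assms by (simp add: positive_semidefinite_def)
  show "0 \<le> (\<Sum>a\<in>U. \<Sum>b\<in>U. x a * (\<Sum>c\<in>V. \<Sum>d\<in>V. K c a * C c d * K d b) * x b)"
    unfolding quadratic_form_transform by (rule nonneg)
qed

section \<open>Normal laws under almost sure equality, image measures and linear maps\<close>

lemma centered_normal_cong_AE:
  assumes "centered_normal M Y v" "Y' \<in> borel_measurable M" "AE \<omega> in M. Y \<omega> = Y' \<omega>"
  shows "centered_normal M Y' v"
proof (cases "v = 0")
  case True
  have "AE \<omega> in M. Y \<omega> = 0" using assms(1) True by (simp add: centered_normal_def)
  with assms(3) have "AE \<omega> in M. Y' \<omega> = 0" by eventually_elim simp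
  with True assms(2) show ?thesis by (simp add: centered_normal_def)
next
  case False
  have "distr M lborel Y = distr M lborel Y'"
    using assms by (intro distr_cong_AE) (auto simp: centered_normal_def)
  then show ?thesis
    using assms False by (simp add: centered_normal_def distributed_def)
qed

text \<open>Both the point mass and the density case depend only on the law of \<open>Y\<close>, and
  the law under the image measure is that of \<open>Y\<close> composed with
  \<open>f\<close>.\<close>

lemma centered_normal_distr:
  assumes f [measurable]: "f \<in> M \<rightarrow>\<^sub>M N" and Y [measurable]: "Y \<in> borel_measurable N"
  shows "centered_normal (distr M N f) Y v \<longleftrightarrow> centered_normal M (\<lambda>\<omega>. Y (f \<omega>)) v"
proof -
  have "(AE \<omega> in distr M N f. Y \<omega> = 0) \<longleftrightarrow> (AE \<omega> in M. Y (f \<omega>) = 0)"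
    by (rule AE_distr_iff) measurable
  moreover have "distr (distr M N f) lborel Y = distr M lborel (\<lambda>\<omega>. Y (f \<omega>))"
    by (subst distr_distr) (auto simp: o_def)
  ultimately show ?thesis
    by (simp add: centered_normal_def distributed_def)
qed

lemma measurable_vector_component:
  assumes "E \<in> M \<rightarrow>\<^sub>M vector_space_on V" "a \<in> V"
  shows "(\<lambda>\<omega>. E \<omega> a) \<in> borel_measurable M"
  by (rule measurable_compose[OF assms(1) measurable_component_singleton[OF assms(2)]])

lemma centered_gaussian_cong_AE:
  assumes "centered_gaussian M V E C" "E' \<in> M \<rightarrow>\<^sub>M vector_space_on V"
    and "AE \<omega> in M. \<forall>a\<in>V. E \<omega> a = E' \<omega> a"
  shows "centered_gaussian M V E' C"
  unfolding centered_gaussian_def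
proof (intro conjI allI)
  fix t
  show "centered_normal M (\<lambda>\<omega>. \<Sum>a\<in>V. t a * E' \<omega> a) (\<Sum>a\<in>V. \<Sum>b\<in>V. t a * C a b * t b)"
  proof (rule centered_normal_cong_AE)
    show "centered_normal M (\<lambda>\<omega>. \<Sum>a\<in>V. t a * E \<omega> a) (\<Sum>a\<in>V. \<Sum>b\<in>V. t a * C a b * t b)"
      using assms(1) by (simp add: centered_gaussian_def)
    show "(\<lambda>\<omega>. \<Sum>a\<in>V. t a * E' \<omega> a) \<in> borel_measurable M"
      using measurable_vector_component[OF assms(2)] by measurable
    show "AE \<omega> in M. (\<Sum>a\<in>V. t a * E \<omega> a) = (\<Sum>a\<in>V. t a * E' \<omega> a)"
      using assms(3) by eventually_elim simp
  qed
qed fact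

lemma centered_gaussian_distr:
  assumes "f \<in> M \<rightarrow>\<^sub>M N" and E: "E \<in> N \<rightarrow>\<^sub>M vector_space_on V"
  shows "centered_gaussian (distr M N f) V E C \<longleftrightarrow> centered_gaussian M V (\<lambda>\<omega>. E (f \<omega>)) C"
proof -
  have "(\<lambda>\<omega>. \<Sum>a\<in>V. t a * E \<omega> a) \<in> borel_measurable N" for t
    using measurable_vector_component[OF E] by measurable
  then show ?thesis
    using assms measurable_compose[OF assms]
    by (simp add: centered_gaussian_def centered_normal_distr[where f = f])
qed

lemma measurable_linear_image:
  assumes "E \<in> M \<rightarrow>\<^sub>M vector_space_on V"
  shows "(\<lambda>\<omega>. \<lambda>b\<in>U. \<Sum>c\<in>V. K c b * E \<omega> c) \<in> M \<rightarrow>\<^sub>M vector_space_on U"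
  using measurable_vector_component[OF assms] by measurable

text \<open>The combination of \<open>K\<^sup>T E\<close> with coefficients \<open>t\<close> is the
  combination of \<open>E\<close> with coefficients \<open>K t\<close>.\<close>

lemma centered_gaussian_linear_image:
  assumes "centered_gaussian M V E C"
  shows "centered_gaussian M U (\<lambda>\<omega>. \<lambda>b\<in>U. \<Sum>c\<in>V. K c b * E \<omega> c)
    (\<lambda>a b. \<Sum>c\<in>V. \<Sum>d\<in>V. K c a * C c d * K d b)"
proof -
  have comb: "(\<Sum>a\<in>U. t a * (\<lambda>b\<in>U. \<Sum>c\<in>V. K c b * E \<omega> c) a) =
      (\<Sum>c\<in>V. (\<Sum>a\<in>U. t a * K c a) * E \<omega> c)" for t \<omega>
    by (simp add: sum_distrib_left sum_distrib_right mult_ac) (rule sum.swap)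
  have normal: "centered_normal M (\<lambda>\<omega>. \<Sum>c\<in>V. s c * E \<omega> c) (\<Sum>c\<in>V. \<Sum>d\<in>V. s c * C c d * s d)" for s
    using assms by (simp add: centered_gaussian_def)
  show ?thesis
    unfolding centered_gaussian_def comb quadratic_form_transform
    using assms by (intro conjI allI normal measurable_linear_image) (simp add: centered_gaussian_def)
qed

lemma centered_gaussian_cong_cov:
  assumes "\<And>a b. a \<in> V \<Longrightarrow> b \<in> V \<Longrightarrow> C a b = C' a b"
  shows "centered_gaussian M V E C \<longleftrightarrow> centered_gaussian M V E C'"
proof -
  have "(\<Sum>a\<in>V. \<Sum>b\<in>V. t a * C a b * t b) = (\<Sum>a\<in>V. \<Sum>b\<in>V. t a * C' a b * t b)" for t
    using assms by (intro sum.cong) auto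
  then show ?thesis by (simp add: centered_gaussian_def)
qed

section \<open>Marginalization\<close>

text \<open>Moves a system from an arbitrary probability space to the space of vectors demanded by
  \<open>gls_distribution\<close>: the law of \<open>X\<close>, with the identity as random
  vector.\<close>

lemma gls_distribution_distr:
  fixes M :: "'w measure" and G :: "'v mixed_graph"
  assumes "prob_space M" "gaussian_linear_system G \<sigma> M X"
  shows "gls_distribution G \<sigma> (distr M (vector_space_on (verts G)) X)"
proof -
  let ?V = "verts G"
  let ?N = "vector_space_on ?V"
  \<comment> \<open>The structural equations solved for the error: \<open>E\<close> equals
    \<open>F\<close> of \<open>X\<close> almost surely, so the error survives the passage to the law
    of \<open>X\<close>.\<close>
  define F where "F = (\<lambda>x. \<lambda>b\<in>?V. x b - (\<Sum>a\<in>?V. beta G \<sigma> a b * x a))"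
  have X: "X \<in> M \<rightarrow>\<^sub>M ?N"
    using assms(2) by (simp add: gaussian_linear_system_def)
  obtain E where E: "centered_gaussian M ?V E (Lambda G \<sigma>)"
    and eq: "AE \<omega> in M. \<forall>b\<in>?V. X \<omega> b = (\<Sum>a\<in>?V. beta G \<sigma> a b * X \<omega> a) + E \<omega> b"
    using assms(2) by (auto simp: gaussian_linear_system_def)
  have F: "F \<in> ?N \<rightarrow>\<^sub>M ?N"
    unfolding F_def by measurable
  have "centered_gaussian M ?V (\<lambda>\<omega>. F (X \<omega>)) (Lambda G \<sigma>)"
    using E measurable_compose[OF X F]
  proof (rule centered_gaussian_cong_AE)
    show "AE \<omega> in M. \<forall>a\<in>?V. E \<omega> a = F (X \<omega>) a"
      using eq
    proof eventually_elim
      case (elim \<omega>)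
      have "E \<omega> b = X \<omega> b - (\<Sum>a\<in>?V. beta G \<sigma> a b * X \<omega> a)" if "b \<in> ?V" for b
        using elim[rule_format, OF that] by linarith
      then show ?case by (simp add: F_def)
    qed
  qed
  then have "centered_gaussian (distr M ?N X) ?V F (Lambda G \<sigma>)"
    by (simp add: centered_gaussian_distr[OF X F])
  then have "gaussian_linear_system G \<sigma> (distr M ?N X) (\<lambda>x. x)"
    unfolding gaussian_linear_system_def by (auto simp: F_def intro!: exI[of _ F])
  moreover have "distr M ?N X = distr (distr M ?N X) ?N (\<lambda>x. x)"
    by (subst distr_distr) (auto simp: X o_def)
  moreover have "prob_space (distr M ?N X)"
    using assms(1) X by (rule prob_space.prob_space_distr)
  ultimately show ?thesis
    unfolding gls_distribution_def by blast
qed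

section \<open>Parameters of the marginal system\<close>

definition marginal_weights :: "'v mixed_graph \<Rightarrow> 'v set \<Rightarrow> 'v weights \<Rightarrow> 'v weights" where
  "marginal_weights G U \<sigma> e = (case e of
     DirE a b \<Rightarrow> walks_weight \<sigma> (directed_walks_avoiding G U a b)
   | BiE a b \<Rightarrow> walks_weight \<sigma> (treks_avoiding G U a b))"

lemma verts_marginal_graph [simp]: "verts (marginal_graph G U) = U"
  by (simp add: marginal_graph_def)

text \<open>Where the marginal graph lacks an edge, the set of walks is empty and has weight 0, the
  default value in \<open>beta\<close>. The same argument works for treks and
  \<open>Lambda\<close>.\<close>

lemma beta_marginal_weights:
  assumes "a \<in> U" "b \<in> U"
  shows "beta (marginal_graph G U) (marginal_weights G U \<sigma>) a b =
    walks_weight \<sigma> (directed_walks_avoiding G U a b)"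
  using assms by (simp add: beta_def marginal_graph_def marginal_weights_def walks_weight_def)

lemma Lambda_marginal_weights:
  assumes "a \<in> U" "b \<in> U"
  shows "Lambda (marginal_graph G U) (marginal_weights G U \<sigma>) a b =
    walks_weight \<sigma> (treks_avoiding G U a b)"
  using assms by (simp add: Lambda_def marginal_graph_def marginal_weights_def walks_weight_def)

lemma weight_function_marginal:
  assumes G: "directed_mixed_graph G" "acyclic_graph G" and "weight_function G \<sigma>"
  shows "weight_function (marginal_graph G U) (marginal_weights G U \<sigma>)"
proof -
  let ?G = "marginal_graph G U" and ?\<sigma> = "marginal_weights G U \<sigma>"
  have "positive_semidefinite U (\<lambda>a b. walks_weight \<sigma> (treks_avoiding G U a b))"
    using assms(3) unfolding trek_weight_eq[OF G] weight_function_def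
    by (intro positive_semidefinite_transform) simp
  then have psd: "positive_semidefinite U (Lambda ?G ?\<sigma>)"
    by (simp add: positive_semidefinite_def Lambda_marginal_weights)
  \<comment> \<open>Symmetry of the weights is read off the symmetric matrix, without reversing
    treks.\<close>
  have "?\<sigma> (BiE a b) = ?\<sigma> (BiE b a)" if "(a, b) \<in> bidirected ?G" for a b
  proof -
    have "a \<in> U" "b \<in> U" using that by (auto simp: marginal_graph_def)
    then have "Lambda ?G ?\<sigma> a b = Lambda ?G ?\<sigma> b a"
      using psd by (simp add: positive_semidefinite_def)
    then show ?thesis
      by (simp add: Lambda_marginal_weights \<open>a \<in> U\<close> \<open>b \<in> U\<close> marginal_weights_def)
  qed
  with psd show ?thesis
    by (auto simp: weight_function_def)
qed

text \<open>An edge of the marginal graph comes from a directed path in \<open>G\<close>, so for any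
  weights the support of \<open>beta\<close> lies in a well-founded relation.\<close>

lemma principally_nonsingular_marginal:
  assumes G: "directed_mixed_graph G" "acyclic_graph G"
  shows "principally_nonsingular W (beta (marginal_graph G U) \<sigma>')"
proof (rule principally_nonsingular_if_wf)
  show "wf (((directed G)\<inverse>)\<^sup>+)"
    using wf_converse_directed[OF G] by (rule wf_trancl)
  have reach: "(b, a) \<in> ((directed G)\<inverse>)\<^sup>*" if "steps G a w b" "right_directed w" for a b w
    using that
  proof (induction w arbitrary: a)
    case (Cons s w)
    then show ?case
      by (cases s) (auto simp: right_directed_def intro: rtrancl_into_rtrancl)
  qed simp
  fix a b
  assume "beta (marginal_graph G U) \<sigma>' a b \<noteq> 0"
  then have "directed_walks_avoiding G U a b \<noteq> {}"
    by (auto simp: beta_def marginal_graph_def split: if_splits)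
  then obtain c w where "(a, c) \<in> directed G" "w \<in> exits G U c b"
    by (auto simp: directed_walks_avoiding_eq)
  then show "(b, a) \<in> ((directed G)\<inverse>)\<^sup>+"
    using reach[of c w b] by (auto simp: exits_def intro: rtrancl_into_trancl1)
qed

lemma structural_equation_marginal:
  assumes G: "directed_mixed_graph G" "acyclic_graph G" and U: "U \<subseteq> verts G" and b: "b \<in> U"
    and eq: "\<And>c. c \<in> verts G \<Longrightarrow> x c = (\<Sum>a\<in>verts G. beta G \<sigma> a c * x a) + e c"
  shows "x b = (\<Sum>a\<in>U. walks_weight \<sigma> (directed_walks_avoiding G U a b) * x a) +
    (\<Sum>c\<in>verts G. walks_weight \<sigma> (exits G U c b) * e c)"
proof -
  let ?V = "verts G"
  let ?K = "\<lambda>c. walks_weight \<sigma> (exits G U c b)"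
  let ?D = "\<lambda>a. walks_weight \<sigma> (directed_walks_avoiding G U a b)"
  have V: "finite ?V"
    using G(1) by (simp add: directed_mixed_graph_def)
  \<comment> \<open>The same sum is evaluated twice; here by expanding \<open>?K\<close>, which
    leaves only \<open>b\<close> and the vertices outside \<open>U\<close>.\<close>
  have "(\<Sum>c\<in>?V. ?K c * x c) = (\<Sum>c\<in>?V. (if c = b then x c else 0) + (if c \<in> U then 0 else ?D c * x c))"
    by (intro sum.cong) (auto simp: exits_weight_eq[OF G] distrib_right)
  also have "\<dots> = x b + (\<Sum>c\<in>?V - U. ?D c * x c)"
    using V U b by (auto simp: sum.distrib sum.If_cases Int_commute Diff_eq)
  finally have lhs: "(\<Sum>c\<in>?V. ?K c * x c) = x b + (\<Sum>c\<in>?V - U. ?D c * x c)" .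
  \<comment> \<open>Second evaluation, by the structural equations; exchanging the sums then forms
    \<open>\<beta> K\<close>, which is \<open>?D\<close>.\<close>
  have "(\<Sum>c\<in>?V. ?K c * x c) = (\<Sum>c\<in>?V. ?K c * ((\<Sum>a\<in>?V. beta G \<sigma> a c * x a) + e c))"
    by (intro sum.cong arg_cong2[where f = "(*)"] refl eq)
  also have "\<dots> = (\<Sum>c\<in>?V. ?K c * (\<Sum>a\<in>?V. beta G \<sigma> a c * x a)) + (\<Sum>c\<in>?V. ?K c * e c)"
    by (simp add: distrib_left sum.distrib)
  also have "(\<Sum>c\<in>?V. ?K c * (\<Sum>a\<in>?V. beta G \<sigma> a c * x a)) =
      (\<Sum>a\<in>?V. \<Sum>c\<in>?V. beta G \<sigma> a c * ?K c * x a)"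
    by (subst sum.swap) (simp add: sum_distrib_left mult_ac)
  also have "\<dots> = (\<Sum>a\<in>?V. ?D a * x a)"
    by (simp add: directed_weight_eq[OF G] sum_distrib_right)
  \<comment> \<open>The part outside \<open>U\<close> is the one in \<open>lhs\<close> and
    cancels.\<close>
  also have "\<dots> = (\<Sum>a\<in>?V - U. ?D a * x a) + (\<Sum>a\<in>U. ?D a * x a)"
    using U V by (rule sum.subset_diff)
  finally show ?thesis using lhs by simp
qed

text \<open>The algebraic identity is applied at almost every outcome, with error
  \<open>K\<^sup>T E\<close>, whose covariance is the trek matrix.\<close>

lemma gaussian_linear_system_marginal:
  assumes G: "directed_mixed_graph G" "acyclic_graph G" and U: "U \<subseteq> verts G"
    and gls: "gaussian_linear_system G \<sigma> M X"
  shows "gaussian_linear_system (marginal_graph G U) (marginal_weights G U \<sigma>) M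
    (\<lambda>\<omega>. restrict (X \<omega>) U)"
proof -
  let ?V = "verts G" and ?G = "marginal_graph G U" and ?\<sigma> = "marginal_weights G U \<sigma>"
  let ?K = "\<lambda>c b. walks_weight \<sigma> (exits G U c b)"
  have X: "X \<in> M \<rightarrow>\<^sub>M vector_space_on ?V"
    using gls by (simp add: gaussian_linear_system_def)
  obtain E where E: "centered_gaussian M ?V E (Lambda G \<sigma>)"
    and eq: "AE \<omega> in M. \<forall>b\<in>?V. X \<omega> b = (\<Sum>a\<in>?V. beta G \<sigma> a b * X \<omega> a) + E \<omega> b"
    using gls by (auto simp: gaussian_linear_system_def)
  define E' where "E' = (\<lambda>\<omega>. \<lambda>b\<in>U. \<Sum>c\<in>?V. ?K c b * E \<omega> c)"
  have "centered_gaussian M U E' (\<lambda>a b. walks_weight \<sigma> (treks_avoiding G U a b))"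
    unfolding E'_def trek_weight_eq[OF G] using E by (rule centered_gaussian_linear_image)
  then have E': "centered_gaussian M U E' (Lambda ?G ?\<sigma>)"
    by (rule centered_gaussian_cong_cov[THEN iffD1, rotated])
      (simp add: Lambda_marginal_weights)
  have "AE \<omega> in M. \<forall>b\<in>U. restrict (X \<omega>) U b =
      (\<Sum>a\<in>U. beta ?G ?\<sigma> a b * restrict (X \<omega>) U a) + E' \<omega> b"
    using eq
  proof eventually_elim
    case (elim \<omega>)
    show ?case
    proof
      fix b
      assume b: "b \<in> U"
      have "(\<Sum>a\<in>U. beta ?G ?\<sigma> a b * restrict (X \<omega>) U a) =
          (\<Sum>a\<in>U. walks_weight \<sigma> (directed_walks_avoiding G U a b) * X \<omega> a)"
        using b by (intro sum.cong) (simp_all add: beta_marginal_weights)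
      then show "restrict (X \<omega>) U b =
          (\<Sum>a\<in>U. beta ?G ?\<sigma> a b * restrict (X \<omega>) U a) + E' \<omega> b"
        using structural_equation_marginal[OF G U b elim[rule_format]] b
        by (simp only: E'_def restrict_apply')
    qed
  qed
  moreover have "(\<lambda>\<omega>. restrict (X \<omega>) U) \<in> M \<rightarrow>\<^sub>M vector_space_on U"
    using measurable_compose[OF X measurable_restrict_subset[OF U]] .
  ultimately show ?thesis
    unfolding gaussian_linear_system_def verts_marginal_graph using E' by blast
qed

theorem theorem3:
  fixes G :: "'v mixed_graph" and U :: "'v set" and \<sigma> :: "'v weights"
    and M :: "'w measure" and X :: "'w \<Rightarrow> 'v \<Rightarrow> real" and P :: "('v \<Rightarrow> real) measure"
  assumes "directed_mixed_graph G" and "acyclic_graph G"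
    and "U \<subseteq> verts G"
    and "weight_function G \<sigma>"
    and "principally_stable (verts G) (beta G \<sigma>)"
    and "prob_space M" and "gaussian_linear_system G \<sigma> M X"
    and "P = distr M (vector_space_on (verts G)) X"
  shows "\<exists>\<sigma>'. weight_function (marginal_graph G U) \<sigma>' \<and>
      (\<forall>a\<in>U. \<forall>b\<in>U.
         beta (marginal_graph G U) \<sigma>' a b = walks_weight \<sigma> (directed_walks_avoiding G U a b)) \<and>
      (\<forall>a\<in>U. \<forall>b\<in>U.
         Lambda (marginal_graph G U) \<sigma>' a b = walks_weight \<sigma> (treks_avoiding G U a b)) \<and>
      principally_nonsingular U (beta (marginal_graph G U) \<sigma>') \<and>
      gls_distribution (marginal_graph G U) \<sigma>' (marginal_distribution P U)"
proof (intro exI conjI)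
  let ?\<sigma> = "marginal_weights G U \<sigma>"
  show "weight_function (marginal_graph G U) ?\<sigma>"
    using assms(1,2,4) by (rule weight_function_marginal)
  show "\<forall>a\<in>U. \<forall>b\<in>U. beta (marginal_graph G U) ?\<sigma> a b =
      walks_weight \<sigma> (directed_walks_avoiding G U a b)"
    by (simp add: beta_marginal_weights)
  show "\<forall>a\<in>U. \<forall>b\<in>U. Lambda (marginal_graph G U) ?\<sigma> a b =
      walks_weight \<sigma> (treks_avoiding G U a b)"
    by (simp add: Lambda_marginal_weights)
  show "principally_nonsingular U (beta (marginal_graph G U) ?\<sigma>)"
    using assms(1,2) by (rule principally_nonsingular_marginal)
  have "X \<in> M \<rightarrow>\<^sub>M vector_space_on (verts G)"
    using assms(7) by (simp add: gaussian_linear_system_def)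
  \<comment> \<open>Projecting the law of \<open>X\<close> gives the law of the restricted vector,
    to which the marginal system applies.\<close>
  then have "marginal_distribution P U = distr M (vector_space_on U) (\<lambda>\<omega>. restrict (X \<omega>) U)"
    unfolding marginal_distribution_def assms(8)
    by (subst distr_distr) (auto simp: o_def measurable_restrict_subset assms(3))
  then show "gls_distribution (marginal_graph G U) ?\<sigma> (marginal_distribution P U)"
    using gls_distribution_distr[OF assms(6)
        gaussian_linear_system_marginal[OF assms(1-3,7)]] by simp
qed

end
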